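(* Let $F=f+\Psi$ and let the generalized ACGM algorithm (either its monotone or its non-monotone variant, as described in the context) be run from $\mathbf{x}_0\in\mathbb{R}^n$ with parameters $L_0>0$, $A_0\ge 0$, $\gamma_0>0$, $r_u>1$, $0<r_d<1$. Put $L_u=\max\{r_uL_f,\,r_dL_0\}$ and $q_u=\mu/(L_u+\mu_\Psi)$. If $\gamma_0\ge A_0\mu$, then the generated sequence $\{\mathbf{x}_k\}_{k\ge1}$ satisfies, for all $k\ge1$, $$F(\mathbf{x}_k)-F(\mathbf{x}^* )\le \min\left\{\frac{4}{(k+1)^2},\ (1-\sqrt{q_u})^{k-1}\right\}(L_u-\mu_f)\,\bar\Delta_0,$$ where $$\bar\Delta_0=\frac{A_0}{\gamma_0}\bigl(F(\mathbf{x}_0)-F(\mathbf{x}^* )\bigr)+\frac12\|\mathbf{x}_0-\mathbf{x}^*\|_2^2 .$$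
   Context: Problem: $f:\mathbb{R}^n\to\mathbb{R}$ is convex and differentiable with $L_f$-Lipschitz gradient ($L_f>0$) and strong convexity parameter $\mu_f\ge0$, i.e. $f-\frac{\mu_f}{2}\|\cdot\|_2^2$ is convex; $\Psi:\mathbb{R}^n\to\mathbb{R}\cup\{+\infty\}$ is convex, lower semicontinuous, not identically $+\infty$, with strong convexity parameter $\mu_\Psi\ge0$, i.e. $\Psi-\frac{\mu_\Psi}{2}\|\cdot\|_2^2$ is convex. (Parameters equal to $0$ are allowed.) $F=f+\Psi$, $\mu=\mu_f+\mu_\Psi$. A minimizer of $F$ is assumed to exist; $\mathbf{x}^*$ is a fixed one. Notation: $Q_{\lambda,\mathbf{y}}(\mathbf{x})=f(\mathbf{y})+\langle\nabla f(\mathbf{y}),\mathbf{x}-\mathbf{y}\rangle+\frac{\lambda}{2}\|\mathbf{x}-\mathbf{y}\|_2^2$; for $L>0$, $T_L(\mathbf{y})=\arg\min_{\mathbf{x}}(Q_{L,\mathbf{y}}(\mathbf{x})+\Psi(\mathbf{x}))=\mathrm{prox}_{\frac1L\Psi}(\mathbf{y}-\frac1L\nabla f(\mathbf{y}))$. Generalized ACGM: set $\mathbf{v}_0=\mathbf{x}_0$. For $k=0,1,2,\dots$: start with the trial value $\hat L=r_dL_k$. For the current trial value compute $$\hat a=\frac{\gamma_k+A_k\mu}{2(\hat L-\mu_f)}\left(1+\sqrt{1+\frac{4(\hat L-\mu_f)A_k\gamma_k}{(\gamma_k+A_k\mu)^2}}\right),\quad \hat A=A_k+\hat a,\quad \hat\gamma=\gamma_k+\hat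 a\mu,$$ $$\hat{\mathbf{y}}=\frac{A_k\hat\gamma\,\mathbf{x}_k+\hat a\gamma_k\mathbf{v}_k}{A_k\hat\gamma+\hat a\gamma_k},\qquad \hat{\mathbf{z}}=T_{\hat L}(\hat{\mathbf{y}}).$$ If $f(\hat{\mathbf{z}})\le Q_{\hat L,\hat{\mathbf{y}}}(\hat{\mathbf{z}})$, accept the trial value; otherwise replace $\hat L$ by $r_u\hat L$ and repeat. With the accepted quantities set $L_{k+1}=\hat L$, $a_{k+1}=\hat a$, $A_{k+1}=\hat A$, $\gamma_{k+1}=\hat\gamma$, $\mathbf{y}_{k+1}=\hat{\mathbf{y}}$, $\mathbf{z}_{k+1}=\hat{\mathbf{z}}$, and $$\mathbf{v}_{k+1}=\frac1{\gamma_{k+1}}\bigl(\gamma_k\mathbf{v}_k+a_{k+1}(L_{k+1}+\mu_\Psi)\mathbf{z}_{k+1}-a_{k+1}(L_{k+1}-\mu_f)\mathbf{y}_{k+1}\bigr).$$ Main iterate: in the monotone variant, $\mathbf{x}_{k+1}=\mathbf{z}_{k+1}$ if $F(\mathbf{z}_{k+1})\le F(\mathbf{x}_k)$ and $\mathbf{x}_{k+1}=\mathbf{x}_k$ otherwise; in the non-monotone variant, $\mathbf{x}_{k+1}=\mathbf{z}_{k+1}$. Standing assumptions: all trial values $\hat L$ encountered exceed $\mu_f$. If $A_0>0$ then $F(\mathbf{x}_0)<\infty$; if $A_0=0$, $\mathbf{x}_0$ may be infeasible and any term multiplied by $A_0$ is read as $0$. *)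

theory Defs
  imports "HOL-Analysis.Analysis"
begin

text \<open>Extended-real-valued functions. In \<^typ>\<open>ereal\<close> we have \<open>0 * \<infinity> = 0\<close>, so the weights
  \<open>0\<close> and \<open>1\<close> are harmless. The definition is only meaningful for functions that never take
  the value \<open>-\<infinity>\<close>.\<close>

definition ereal_convex :: "('a::real_vector \<Rightarrow> ereal) \<Rightarrow> bool" where
  "ereal_convex g \<longleftrightarrow>
     (\<forall>x y. \<forall>u\<ge>0. \<forall>v\<ge>0. u + v = 1 \<longrightarrow>
        g (u *\<^sub>R x + v *\<^sub>R y) \<le> ereal u * g x + ereal v * g y)"

definition lower_semicontinuous :: "('a::topological_space \<Rightarrow> ereal) \<Rightarrow> bool" where
  "lower_semicontinuous g \<longleftrightarrow> (\<forall>x. g x \<le> Liminf (at x) g)"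

definition objective :: "('a \<Rightarrow> real) \<Rightarrow> ('a \<Rightarrow> ereal) \<Rightarrow> 'a \<Rightarrow> ereal" where
  "objective f \<Psi> x = ereal (f x) + \<Psi> x"

definition quad_model ::
    "('a::real_inner \<Rightarrow> real) \<Rightarrow> ('a \<Rightarrow> 'a) \<Rightarrow> real \<Rightarrow> 'a \<Rightarrow> 'a \<Rightarrow> real" where
  "quad_model f grad_f l y x = f y + grad_f y \<bullet> (x - y) + l / 2 * (norm (x - y))\<^sup>2"

definition prox_grad ::
    "('a::real_inner \<Rightarrow> real) \<Rightarrow> ('a \<Rightarrow> 'a) \<Rightarrow> ('a \<Rightarrow> ereal) \<Rightarrow> real \<Rightarrow> 'a \<Rightarrow> 'a" where
  "prox_grad f grad_f \<Psi> L y = (ARG_MIN (\<lambda>x. ereal (quad_model f grad_f L y x) + \<Psi> x) x. True)"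

record 'a acgm_state =
  main_pt :: 'a       \<comment> \<open>\<open>x\<^sub>k\<close>\<close>
  est_pt :: 'a        \<comment> \<open>\<open>v\<^sub>k\<close>\<close>
  lip :: real         \<comment> \<open>\<open>L\<^sub>k\<close>\<close>
  acc_wt :: real      \<comment> \<open>\<open>A\<^sub>k\<close>\<close>
  curv :: real        \<comment> \<open>\<open>\<gamma>\<^sub>k\<close>\<close>

text \<open>The quantities computed from state \<open>s\<close> for a trial value \<open>L\<close>;
  throughout, \<open>\<mu> = \<mu>f + \<mu>\<Psi>\<close>.\<close>

definition trial_a :: "real \<Rightarrow> real \<Rightarrow> 'a acgm_state \<Rightarrow> real \<Rightarrow> real" where
  "trial_a \<mu>f \<mu>\<Psi> s L =
     (let \<mu> = \<mu>f + \<mu>\<Psi>; A = acc_wt s; \<gamma> = curv s in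
        (\<gamma> + A * \<mu>) / (2 * (L - \<mu>f)) *
        (1 + sqrt (1 + 4 * (L - \<mu>f) * A * \<gamma> / (\<gamma> + A * \<mu>)\<^sup>2)))"

definition trial_A :: "real \<Rightarrow> real \<Rightarrow> 'a acgm_state \<Rightarrow> real \<Rightarrow> real" where
  "trial_A \<mu>f \<mu>\<Psi> s L = acc_wt s + trial_a \<mu>f \<mu>\<Psi> s L"

definition trial_\<gamma> :: "real \<Rightarrow> real \<Rightarrow> 'a acgm_state \<Rightarrow> real \<Rightarrow> real" where
  "trial_\<gamma> \<mu>f \<mu>\<Psi> s L = curv s + trial_a \<mu>f \<mu>\<Psi> s L * (\<mu>f + \<mu>\<Psi>)"

definition trial_y :: "real \<Rightarrow> real \<Rightarrow> ('a::real_inner) acgm_state \<Rightarrow> real \<Rightarrow> 'a" where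
  "trial_y \<mu>f \<mu>\<Psi> s L =
     (let a = trial_a \<mu>f \<mu>\<Psi> s L; \<gamma>' = trial_\<gamma> \<mu>f \<mu>\<Psi> s L; A = acc_wt s; \<gamma> = curv s in
        (1 / (A * \<gamma>' + a * \<gamma>)) *\<^sub>R ((A * \<gamma>') *\<^sub>R main_pt s + (a * \<gamma>) *\<^sub>R est_pt s))"

definition trial_z ::
    "('a::real_inner \<Rightarrow> real) \<Rightarrow> ('a \<Rightarrow> 'a) \<Rightarrow> ('a \<Rightarrow> ereal) \<Rightarrow> real \<Rightarrow> real \<Rightarrow>
     'a acgm_state \<Rightarrow> real \<Rightarrow> 'a" where
  "trial_z f grad_f \<Psi> \<mu>f \<mu>\<Psi> s L = prox_grad f grad_f \<Psi> L (trial_y \<mu>f \<mu>\<Psi> s L)"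

definition accepted ::
    "('a::real_inner \<Rightarrow> real) \<Rightarrow> ('a \<Rightarrow> 'a) \<Rightarrow> ('a \<Rightarrow> ereal) \<Rightarrow> real \<Rightarrow> real \<Rightarrow>
     'a acgm_state \<Rightarrow> real \<Rightarrow> bool" where
  "accepted f grad_f \<Psi> \<mu>f \<mu>\<Psi> s L \<longleftrightarrow>
     f (trial_z f grad_f \<Psi> \<mu>f \<mu>\<Psi> s L)
       \<le> quad_model f grad_f L (trial_y \<mu>f \<mu>\<Psi> s L) (trial_z f grad_f \<Psi> \<mu>f \<mu>\<Psi> s L)"

text \<open>The trial value after \<open>j\<close> rejections, and the number of rejections before the first
  acceptance. The latter is a genuine minimum only if some trial value is accepted; this is not
  assumed anywhere (it follows from the Lipschitz continuity of the gradient).\<close>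

definition trial_L :: "real \<Rightarrow> real \<Rightarrow> 'a acgm_state \<Rightarrow> nat \<Rightarrow> real" where
  "trial_L r\<^sub>u r\<^sub>d s j = r\<^sub>u ^ j * (r\<^sub>d * lip s)"

definition rejections ::
    "('a::real_inner \<Rightarrow> real) \<Rightarrow> ('a \<Rightarrow> 'a) \<Rightarrow> ('a \<Rightarrow> ereal) \<Rightarrow> real \<Rightarrow> real \<Rightarrow>
     real \<Rightarrow> real \<Rightarrow> 'a acgm_state \<Rightarrow> nat" where
  "rejections f grad_f \<Psi> \<mu>f \<mu>\<Psi> r\<^sub>u r\<^sub>d s =
     (LEAST j. accepted f grad_f \<Psi> \<mu>f \<mu>\<Psi> s (trial_L r\<^sub>u r\<^sub>d s j))"

definition acgm_step ::
    "bool \<Rightarrow> ('a::real_inner \<Rightarrow> real) \<Rightarrow> ('a \<Rightarrow> 'a) \<Rightarrow> ('a \<Rightarrow> ereal) \<Rightarrow> real \<Rightarrow> real \<Rightarrow>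
     real \<Rightarrow> real \<Rightarrow> 'a acgm_state \<Rightarrow> 'a acgm_state" where
  "acgm_step monotone_variant f grad_f \<Psi> \<mu>f \<mu>\<Psi> r\<^sub>u r\<^sub>d s =
     (let L = trial_L r\<^sub>u r\<^sub>d s (rejections f grad_f \<Psi> \<mu>f \<mu>\<Psi> r\<^sub>u r\<^sub>d s);
          a = trial_a \<mu>f \<mu>\<Psi> s L;
          \<gamma>' = trial_\<gamma> \<mu>f \<mu>\<Psi> s L;
          y = trial_y \<mu>f \<mu>\<Psi> s L;
          z = trial_z f grad_f \<Psi> \<mu>f \<mu>\<Psi> s L
      in \<lparr> main_pt =
             (if monotone_variant \<and> \<not> objective f \<Psi> z \<le> objective f \<Psi> (main_pt s)
              then main_pt s else z),
           est_pt =
             (1 / \<gamma>') *\<^sub>R (curv s *\<^sub>R est_pt s + (a * (L + \<mu>\<Psi>)) *\<^sub>R z - (a * (L - \<mu>f)) *\<^sub>R y),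
           lip = L,
           acc_wt = trial_A \<mu>f \<mu>\<Psi> s L,
           curv = \<gamma>' \<rparr>)"

primrec acgm ::
    "bool \<Rightarrow> ('a::real_inner \<Rightarrow> real) \<Rightarrow> ('a \<Rightarrow> 'a) \<Rightarrow> ('a \<Rightarrow> ereal) \<Rightarrow> real \<Rightarrow> real \<Rightarrow>
     real \<Rightarrow> real \<Rightarrow> real \<Rightarrow> real \<Rightarrow> real \<Rightarrow> 'a \<Rightarrow> nat \<Rightarrow> 'a acgm_state" where
  "acgm monotone_variant f grad_f \<Psi> \<mu>f \<mu>\<Psi> r\<^sub>u r\<^sub>d L\<^sub>0 A\<^sub>0 \<gamma>\<^sub>0 x\<^sub>0 0 =
     \<lparr> main_pt = x\<^sub>0, est_pt = x\<^sub>0, lip = L\<^sub>0, acc_wt = A\<^sub>0, curv = \<gamma>\<^sub>0 \<rparr>"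
| "acgm monotone_variant f grad_f \<Psi> \<mu>f \<mu>\<Psi> r\<^sub>u r\<^sub>d L\<^sub>0 A\<^sub>0 \<gamma>\<^sub>0 x\<^sub>0 (Suc k) =
     acgm_step monotone_variant f grad_f \<Psi> \<mu>f \<mu>\<Psi> r\<^sub>u r\<^sub>d
       (acgm monotone_variant f grad_f \<Psi> \<mu>f \<mu>\<Psi> r\<^sub>u r\<^sub>d L\<^sub>0 A\<^sub>0 \<gamma>\<^sub>0 x\<^sub>0 k)"

end

theory Submission
  imports Defs
begin

text \<open>
  The proof is a potential argument. Write \<open>gap p = F p - F xstar\<close> and let
  \<open>A gap(x) + \<gamma>/2 \<parallel>v - xstar\<parallel>\<^sup>2\<close> be the potential of a state. It never increases along the run,
  so \<open>A\<^sub>k gap(x\<^sub>k)\<close> never exceeds the initial potential, which is \<open>\<gamma>\<^sub>0 \<Delta>\<^sub>0\<close> because \<open>v\<^sub>0 = x\<^sub>0\<close>;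
  the convergence rate is then the growth rate of the weights \<open>A\<^sub>k\<close>.

  \<^emph>\<open>Descent of the potential.\<close> The model \<open>Q\<^bsub>L,y\<^esub> + \<Psi>\<close> is strongly convex with parameter
  \<open>L + \<mu>\<Psi>\<close>, hence grows quadratically away from its minimizer \<open>z\<close>. The acceptance test bounds
  \<open>F z\<close> by the model at \<open>z\<close>, and strong convexity of \<open>f\<close> bounds the model at any \<open>x\<close> by
  \<open>F x + (L - \<mu>f)/2 \<parallel>x - y\<parallel>\<^sup>2\<close>. Together (lemma \<open>prox_grad_gap_inequality\<close>), for every feasible \<open>x\<close>,
  \<open>gap z + (L + \<mu>\<Psi>)/2 \<parallel>x - z\<parallel>\<^sup>2 \<le> gap x + (L - \<mu>f)/2 \<parallel>x - y\<parallel>\<^sup>2\<close>.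
  This is used at \<open>x\<^sub>k\<close> with weight \<open>A\<^sub>k\<close> and at \<open>xstar\<close> with weight \<open>a\<close>. The points
  \<open>y\<close>, \<open>v\<close> and the number \<open>a\<close> are chosen so that the remaining quadratic terms telescope, which
  is the purely Euclidean lemma \<open>estimate_point_inequality\<close>. When \<open>A\<^sub>0 = 0\<close> the starting point
  may be infeasible; its inequality then carries the weight \<open>0\<close>.

  \<^emph>\<open>Growth of the weights.\<close> The step weight solves \<open>(L - \<mu>f) a\<^sup>2 = A \<gamma>' + a \<gamma>\<close>, equivalently
  \<open>(L + \<mu>\<Psi>) a\<^sup>2 = A' \<gamma>'\<close> with \<open>A' = A + a\<close>. As \<open>\<gamma>\<close> never drops below \<open>\<gamma>\<^sub>0\<close>, the first form gives
  \<open>\<gamma>\<^sub>0 A' \<le> (L - \<mu>f) a\<^sup>2\<close>, so \<open>\<surd>A\<close> grows by at least a fixed amount per step. The difference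
  \<open>\<gamma> - A \<mu>\<close> is conserved, so \<open>\<gamma>\<^sub>0 \<ge> A\<^sub>0 \<mu>\<close> yields \<open>\<gamma>' \<ge> A' \<mu>\<close>, and the second form gives
  \<open>\<mu> A'\<^sup>2 \<le> (L + \<mu>\<Psi>) a\<^sup>2\<close>, a geometric growth. The estimate \<open>L \<le> L\<^sub>u\<close> holds because, by the
  descent lemma, a trial value of at least \<open>L\<^sub>f\<close> is always accepted.
\<close>

section \<open>Smooth and strongly convex functions\<close>

lemma gderiv_along_line:
  fixes f :: "'a::real_inner \<Rightarrow> real"
  assumes "\<And>p. GDERIV f p :> grad_f p"
  shows "((\<lambda>t. f (y + t *\<^sub>R d)) has_field_derivative (grad_f (y + t *\<^sub>R d) \<bullet> d)) (at t)"
proof -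
  have "((\<lambda>t. f (y + t *\<^sub>R d)) has_derivative (\<lambda>h. (h *\<^sub>R d) \<bullet> grad_f (y + t *\<^sub>R d))) (at t)"
    using assms[unfolded gderiv_def]
    by (intro has_derivative_compose[of "\<lambda>t. y + t *\<^sub>R d" _ _ _ f]) (auto intro!: derivative_eq_intros)
  moreover have "(\<lambda>h. (h *\<^sub>R d) \<bullet> grad_f (y + t *\<^sub>R d)) = (*) (grad_f (y + t *\<^sub>R d) \<bullet> d)"
    by (auto simp: inner_commute)
  ultimately show ?thesis
    by (simp add: has_field_derivative_def)
qed

text \<open>Along the segment from \<open>y\<close> to \<open>z\<close>, the Lipschitz bound makes the derivative of
  \<open>f\<close> minus the quadratic model nonpositive.\<close>

lemma descent_lemma:
  fixes f :: "'a::real_inner \<Rightarrow> real"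
  assumes deriv: "\<And>p. GDERIV f p :> grad_f p"
    and lip: "L-lipschitz_on UNIV grad_f"
  shows "f z \<le> quad_model f grad_f L y z"
proof -
  define d where "d = z - y"
  define g where "g t = f (y + t *\<^sub>R d) - t * (grad_f y \<bullet> d) - L / 2 * t\<^sup>2 * (norm d)\<^sup>2" for t
  \<comment> \<open>The value of \<open>g\<close> at \<open>0\<close> is \<open>f y\<close>, and at \<open>1\<close> it is \<open>f z\<close> minus the rest of the model.\<close>
  have "g 1 \<le> g 0"
  proof (rule DERIV_nonpos_imp_nonincreasing[of 0 1 g])
    fix t :: real
    assume t: "0 \<le> t" "t \<le> 1"
    let ?g' = "grad_f (y + t *\<^sub>R d) \<bullet> d - grad_f y \<bullet> d - L * t * (norm d)\<^sup>2"
    have "(g has_field_derivative ?g') (at t)"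
      unfolding g_def by (auto intro!: derivative_eq_intros gderiv_along_line[OF deriv])
    moreover have "?g' \<le> 0"
    proof -
      have "grad_f (y + t *\<^sub>R d) \<bullet> d - grad_f y \<bullet> d = (grad_f (y + t *\<^sub>R d) - grad_f y) \<bullet> d"
        by (simp add: inner_diff_left)
      also have "\<dots> \<le> norm (grad_f (y + t *\<^sub>R d) - grad_f y) * norm d"
        by (rule norm_cauchy_schwarz)
      also have "\<dots> \<le> (L * norm (t *\<^sub>R d)) * norm d"
        using lipschitz_onD[OF lip, of "y + t *\<^sub>R d" y]
        by (intro mult_right_mono) (auto simp: dist_norm)
      finally show ?thesis
        using t by (simp add: power2_eq_square mult_ac)
    qed
    ultimately show "\<exists>g'. (g has_field_derivative g') (at t) \<and> g' \<le> 0"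
      by blast
  qed simp
  then show ?thesis
    by (simp add: g_def quad_model_def d_def)
qed

text \<open>The tangent inequality for the convex function \<open>f - m/2 \<parallel>\<cdot>\<parallel>\<^sup>2\<close>, restricted to
  the line through \<open>y\<close> and \<open>x\<close>. Completing the square turns its tangent into the quadratic
  model with curvature \<open>m\<close>.\<close>

lemma strongly_convex_above_quad_model:
  fixes f :: "'a::real_inner \<Rightarrow> real"
  assumes deriv: "\<And>p. GDERIV f p :> grad_f p"
    and convex: "convex_on UNIV (\<lambda>p. f p - m / 2 * (norm p)\<^sup>2)"
  shows "quad_model f grad_f m y x \<le> f x"
proof -
  define d where "d = x - y"
  define g where "g t = f (y + t *\<^sub>R d) - m / 2 * (norm (y + t *\<^sub>R d))\<^sup>2" for t
  have sq: "(norm (y + t *\<^sub>R d))\<^sup>2 = (norm y)\<^sup>2 + 2 * t * (y \<bullet> d) + t\<^sup>2 * (norm d)\<^sup>2" for t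
    by (simp only: power2_norm_eq_inner)
       (simp add: inner_add_left inner_add_right inner_commute power2_eq_square algebra_simps)
  have "convex_on UNIV g"
  proof (rule convex_onI)
    fix t a b :: real
    assume t: "0 < t" "t < 1"
    have "y + ((1 - t) *\<^sub>R a + t *\<^sub>R b) *\<^sub>R d = (1 - t) *\<^sub>R (y + a *\<^sub>R d) + t *\<^sub>R (y + b *\<^sub>R d)"
      by (simp add: algebra_simps)
    then show "g ((1 - t) *\<^sub>R a + t *\<^sub>R b) \<le> (1 - t) * g a + t * g b"
      using convex_onD[OF convex, of t "y + a *\<^sub>R d" "y + b *\<^sub>R d"] t by (simp add: g_def)
  qed simp
  moreover have "(g has_field_derivative (grad_f y \<bullet> d - m * (y \<bullet> d))) (at 0)"
    unfolding g_def sq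
    by (auto intro!: derivative_eq_intros gderiv_along_line[OF deriv, THEN DERIV_cong])
  ultimately have "(grad_f y \<bullet> d - m * (y \<bullet> d)) * (1 - 0) \<le> g 1 - g 0"
    by (intro convex_on_imp_above_tangent[of UNIV]) auto
  moreover have "g 0 = f y - m / 2 * (norm y)\<^sup>2"
    by (simp add: g_def)
  moreover have "g 1 = f x - m / 2 * ((norm y)\<^sup>2 + 2 * (y \<bullet> d) + (norm d)\<^sup>2)"
    unfolding g_def sq by (simp add: d_def)
  ultimately show ?thesis
    by (simp add: quad_model_def algebra_simps flip: d_def)
qed

section \<open>Minimizers\<close>

lemma lower_semicontinuous_imp_open_superlevel:
  assumes "lower_semicontinuous g"
  shows "open {x. c < g x}"
proof (subst open_subopen, intro ballI)
  fix x assume "x \<in> {x. c < g x}"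
  then have x: "c < g x" by simp
  then have "eventually (\<lambda>w. c < g w) (at x)"
    using assms by (auto simp: lower_semicontinuous_def le_Liminf_iff)
  then obtain S where "open S" "x \<in> S" "\<And>w. w \<in> S \<Longrightarrow> w \<noteq> x \<Longrightarrow> c < g w"
    by (auto simp: eventually_at_topological)
  then show "\<exists>T. open T \<and> x \<in> T \<and> T \<subseteq> {x. c < g x}"
    using x by (intro exI[of _ S]) auto
qed

text \<open>If no point of \<open>K\<close> were a minimizer, the open sets \<open>{z. g w < g z}\<close> for \<open>w\<close> in \<open>K\<close>
  would cover \<open>K\<close>; among the finitely many \<open>w\<close> of a subcover, one with the least value would itself be uncovered.\<close>

lemma lower_semicontinuous_attains_min:
  fixes g :: "'a::topological_space \<Rightarrow> ereal"
  assumes lsc: "lower_semicontinuous g" and K: "compact K" "K \<noteq> {}"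
  obtains z where "z \<in> K" "\<And>w. w \<in> K \<Longrightarrow> g z \<le> g w"
proof (rule ccontr)
  assume "\<not> thesis"
  with that have "\<And>z. z \<in> K \<Longrightarrow> \<exists>w\<in>K. g w < g z"
    by (meson not_le)
  then have "K \<subseteq> (\<Union>w\<in>K. {z. g w < g z})"
    by auto
  then obtain D where D: "D \<subseteq> K" "finite D" "K \<subseteq> (\<Union>w\<in>D. {z. g w < g z})"
    using compactE_image[OF K(1), of K "\<lambda>w. {z. g w < g z}"]
      lower_semicontinuous_imp_open_superlevel[OF lsc] by metis
  have "D \<noteq> {}"
    using D K by auto
  then have m: "arg_min_on g D \<in> D" "\<And>w. w \<in> D \<Longrightarrow> g (arg_min_on g D) \<le> g w"
    using arg_min_if_finite[OF D(2), of g] arg_min_least[OF D(2), of _ g] by auto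
  then obtain w where "w \<in> D" "g w < g (arg_min_on g D)"
    using D by blast
  with m(2) show False
    by (meson not_le)
qed

lemma lower_semicontinuous_add_continuous:
  fixes q :: "'a::topological_space \<Rightarrow> real"
  assumes q: "continuous_on UNIV q" and g: "lower_semicontinuous g" "\<And>x. g x \<noteq> -\<infinity>"
  shows "lower_semicontinuous (\<lambda>x. ereal (q x) + g x)"
  unfolding lower_semicontinuous_def le_Liminf_iff
proof (intro allI impI)
  fix x c assume c: "c < ereal (q x) + g x"
  show "eventually (\<lambda>w. c < ereal (q w) + g w) (at x)"
  proof (cases c)
    case PInf
    with c show ?thesis by simp
  next
    case MInf
    have "-\<infinity> < ereal (q w) + g w" for w
      using g(2)[of w] by (cases "g w") auto
    with MInf show ?thesis by simp
  next
    case (real r)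
    then have "ereal (r - q x) < g x"
      using c g(2)[of x] by (cases "g x") auto
    then obtain d where d: "ereal (r - q x) < ereal d" "ereal d < g x"
      using ereal_dense2 by metis
    have "eventually (\<lambda>w. ereal d < g w) (at x)"
      using g(1) d(2) by (auto simp: lower_semicontinuous_def le_Liminf_iff)
    moreover have "eventually (\<lambda>w. r - d < q w) (at x)"
    proof -
      have "(q \<longlongrightarrow> q x) (at x)"
        using q by (auto simp: continuous_on_def)
      moreover have "r - d < q x" using d by simp
      ultimately show ?thesis by (rule order_tendstoD)
    qed
    ultimately show ?thesis
    proof eventually_elim
      case (elim w)
      then show ?case
        using real by (cases "g w") auto
    qed
  qed
qed

text \<open>Only pairs of points with finite values are constrained. This is the full content when
  \<open>g\<close> never equals \<open>-\<infinity>\<close>, since the usual right-hand side is infinite at the other pairs with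
  positive weights, and it keeps the inequality between real numbers.\<close>

definition strongly_convex :: "real \<Rightarrow> ('a::real_normed_vector \<Rightarrow> ereal) \<Rightarrow> bool" where
  "strongly_convex c g \<longleftrightarrow>
     (\<forall>x y r s u v. g x = ereal r \<longrightarrow> g y = ereal s \<longrightarrow> 0 \<le> u \<longrightarrow> 0 \<le> v \<longrightarrow> u + v = 1 \<longrightarrow>
        g (u *\<^sub>R x + v *\<^sub>R y) \<le> ereal (u * r + v * s - c / 2 * u * v * (norm (x - y))\<^sup>2))"

lemma strongly_convexD:
  assumes "strongly_convex c g" "g x = ereal r" "g y = ereal s" "0 \<le> t" "t \<le> 1"
  shows "g ((1 - t) *\<^sub>R x + t *\<^sub>R y)
           \<le> ereal ((1 - t) * r + t * s - c / 2 * (1 - t) * t * (norm (x - y))\<^sup>2)"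
  using assms unfolding strongly_convex_def by (metis add.commute diff_add_cancel diff_ge_0_iff_ge)

lemma norm_sq_convex_combination:
  fixes x y :: "'a::real_inner"
  assumes "u + v = 1"
  shows "(norm (u *\<^sub>R x + v *\<^sub>R y))\<^sup>2 = u * (norm x)\<^sup>2 + v * (norm y)\<^sup>2 - u * v * (norm (x - y))\<^sup>2"
proof -
  have v: "v = 1 - u" using assms by simp
  show ?thesis
    unfolding v
    by (simp only: power2_norm_eq_inner)
       (simp add: inner_add_left inner_add_right inner_diff_left inner_diff_right inner_commute
          algebra_simps)
qed

lemma strongly_convexI_ereal_convex:
  fixes g :: "'a::real_inner \<Rightarrow> ereal"
  assumes "ereal_convex (\<lambda>p. g p - ereal (c / 2 * (norm p)\<^sup>2))"
  shows "strongly_convex c g"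
  unfolding strongly_convex_def
proof (intro allI impI)
  fix x y r s u v
  assume h: "g x = ereal r" "g y = ereal s" "0 \<le> u" "0 \<le> v" "u + v = (1::real)"
  let ?w = "u *\<^sub>R x + v *\<^sub>R y"
  have "g ?w - ereal (c / 2 * (norm ?w)\<^sup>2)
      \<le> ereal u * (g x - ereal (c / 2 * (norm x)\<^sup>2)) + ereal v * (g y - ereal (c / 2 * (norm y)\<^sup>2))"
    using assms h(3-) by (simp add: ereal_convex_def)
  also have "\<dots> = ereal (u * (r - c / 2 * (norm x)\<^sup>2) + v * (s - c / 2 * (norm y)\<^sup>2))"
    by (simp add: h)
  finally have "g ?w \<le> ereal (u * (r - c / 2 * (norm x)\<^sup>2) + v * (s - c / 2 * (norm y)\<^sup>2)
      + c / 2 * (norm ?w)\<^sup>2)"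
    by (cases "g ?w") auto
  also have "\<dots> = ereal (u * r + v * s - c / 2 * u * v * (norm (x - y))\<^sup>2)"
    by (simp add: norm_sq_convex_combination[OF h(5)] algebra_simps)
  finally show "g ?w \<le> ereal (u * r + v * s - c / 2 * u * v * (norm (x - y))\<^sup>2)" .
qed

text \<open>A quadratic model satisfies the strong convexity inequality with equality, so its
  curvature adds to the parameter of the other summand.\<close>

lemma strongly_convex_quad_model_plus:
  fixes g :: "'a::real_inner \<Rightarrow> ereal"
  assumes "strongly_convex c g"
  shows "strongly_convex (l + c) (\<lambda>x. ereal (quad_model f grad_f l y x) + g x)"
  unfolding strongly_convex_def
proof (intro allI impI)
  fix a b r s u v
  let ?q = "quad_model f grad_f l y"
  assume h: "ereal (?q a) + g a = ereal r" "ereal (?q b) + g b = ereal s"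
    "0 \<le> u" "0 \<le> v" "u + v = (1::real)"
  let ?w = "u *\<^sub>R a + v *\<^sub>R b"
  have ga: "g a = ereal (r - ?q a)"
    using h(1) by (cases "g a") auto
  have gb: "g b = ereal (s - ?q b)"
    using h(2) by (cases "g b") auto
  have g: "g ?w \<le> ereal (u * (r - ?q a) + v * (s - ?q b) - c / 2 * u * v * (norm (a - b))\<^sup>2)"
    using assms ga gb h(3-) by (simp add: strongly_convex_def)
  have "?w - (u *\<^sub>R y + v *\<^sub>R y) = u *\<^sub>R (a - y) + v *\<^sub>R (b - y)"
    by (simp add: algebra_simps)
  moreover have "u *\<^sub>R y + v *\<^sub>R y = y"
    by (simp add: h(5) flip: scaleR_add_left)
  ultimately have "?w - y = u *\<^sub>R (a - y) + v *\<^sub>R (b - y)"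
    by simp
  moreover have sq: "(norm (u *\<^sub>R (a - y) + v *\<^sub>R (b - y)))\<^sup>2
      = u * (norm (a - y))\<^sup>2 + v * (norm (b - y))\<^sup>2 - u * v * (norm (a - b))\<^sup>2"
    using norm_sq_convex_combination[OF h(5), of "a - y" "b - y"] by simp
  ultimately have "?q ?w = (u + v) * f y + grad_f y \<bullet> (u *\<^sub>R (a - y) + v *\<^sub>R (b - y))
      + l / 2 * (norm (u *\<^sub>R (a - y) + v *\<^sub>R (b - y)))\<^sup>2"
    by (simp add: quad_model_def h(5))
  also have "\<dots> = u * ?q a + v * ?q b - l / 2 * u * v * (norm (a - b))\<^sup>2"
    unfolding sq by (simp add: quad_model_def inner_add_right algebra_simps)
  finally show "ereal (?q ?w) + g ?w
      \<le> ereal (u * r + v * s - (l + c) / 2 * u * v * (norm (a - b))\<^sup>2)"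
    using g by (cases "g ?w") (auto simp: algebra_simps add_divide_distrib)
qed

text \<open>Existence needs coercivity. On the unit ball around a point \<open>p\<close> of finite value \<open>r\<close>, the
  function has a lower bound \<open>m\<close>. If \<open>h w \<le> r\<close> for some \<open>w\<close> at distance \<open>t > 1\<close> from \<open>p\<close>, strong convexity at
  the point of the segment \<open>pw\<close> at distance \<open>1\<close> from \<open>p\<close> gives \<open>m \<le> r - c/2 (t - 1)\<close>. So
  the sublevel set of \<open>p\<close> lies in a fixed ball, where compactness applies.\<close>

lemma strongly_convex_min_exists:
  fixes h :: "'a::{real_normed_vector, heine_borel} \<Rightarrow> ereal"
  assumes sc: "strongly_convex c h" and "0 < c"
    and lsc: "lower_semicontinuous h" and no_minf: "\<And>x. h x \<noteq> -\<infinity>" and p: "h p \<noteq> \<infinity>"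
  obtains z where "\<And>w. h z \<le> h w"
proof -
  obtain r where r: "h p = ereal r"
    using p no_minf[of p] by (cases "h p") auto
  obtain z1 where z1: "\<And>w. w \<in> cball p 1 \<Longrightarrow> h z1 \<le> h w"
    using lower_semicontinuous_attains_min[OF lsc, of "cball p 1"] by auto
  then have "h z1 \<le> ereal r"
    using r[symmetric] by simp
  then obtain m where m: "h z1 = ereal m"
    using no_minf[of z1] by (cases "h z1") auto
  define R where "R = max 1 (1 + 2 * (r - m) / c)"
  obtain z where z: "\<And>w. w \<in> cball p R \<Longrightarrow> h z \<le> h w"
    using lower_semicontinuous_attains_min[OF lsc, of "cball p R"] by (auto simp: R_def)
  have "h z \<le> h w" for w
  proof (cases "h w \<le> h p \<and> w \<notin> cball p R")
    case True
    define t where "t = norm (p - w)"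
    have t: "1 < t" "1 + 2 * (r - m) / c < t"
      using True by (auto simp: t_def R_def dist_norm)
    obtain s where s: "h w = ereal s" "s \<le> r"
      using True no_minf[of w] r by (cases "h w") auto
    \<comment> \<open>The point of the segment from \<open>p\<close> to \<open>w\<close> at distance \<open>1\<close> from \<open>p\<close>.\<close>
    let ?v = "(1 - 1 / t) *\<^sub>R p + (1 / t) *\<^sub>R w"
    have "p - ?v = (1 / t) *\<^sub>R (p - w)"
      by (simp add: algebra_simps)
    then have "?v \<in> cball p 1"
      using t(1) by (auto simp: dist_norm t_def)
    then have "h z1 \<le> h ?v"
      by (rule z1)
    also have "\<dots> \<le> ereal ((1 - 1 / t) * r + 1 / t * s - c / 2 * (1 - 1 / t) * (1 / t) * (norm (p - w))\<^sup>2)"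
      using t by (intro strongly_convexD[OF sc r s(1)]) auto
    finally have "m \<le> (1 - 1 / t) * r + 1 / t * s - c / 2 * (1 - 1 / t) * (1 / t) * t\<^sup>2"
      using m by (simp add: t_def)
    also have "\<dots> \<le> (1 - 1 / t) * r + 1 / t * r - c / 2 * (1 - 1 / t) * (1 / t) * t\<^sup>2"
      using s t by (intro diff_right_mono add_left_mono mult_left_mono) auto
    also have "\<dots> = r - c / 2 * (t - 1)"
      using t by (simp add: field_simps power2_eq_square)
    finally have "t \<le> 1 + 2 * (r - m) / c"
      using \<open>0 < c\<close> by (simp add: field_simps)
    with t(2) show ?thesis by simp
  next
    case False
    have "h z \<le> h p"
      by (rule z) (simp add: R_def)
    with False z[of w] show ?thesis by auto
  qed
  then show thesis by (rule that)
qed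

text \<open>This replaces the optimality condition \<open>0 \<in> \<partial>h z\<close>: comparing \<open>h z\<close> with \<open>h\<close> at
  a point moved by a fraction \<open>t\<close> towards \<open>x\<close>, dividing by \<open>t\<close> and letting \<open>t\<close> tend to \<open>0\<close>
  avoids subgradients.\<close>

lemma strongly_convex_min_growth:
  assumes sc: "strongly_convex c h" and z: "\<And>w. h z \<le> h w"
    and r: "h z = ereal r" and s: "h x = ereal s"
  shows "r + c / 2 * (norm (x - z))\<^sup>2 \<le> s"
proof -
  let ?D = "(norm (z - x))\<^sup>2"
  have "((\<lambda>t. r + c / 2 * (1 - t) * ?D) \<longlongrightarrow> r + c / 2 * (1 - 0) * ?D) (at_right 0)"
    by (intro tendsto_intros)
  moreover have "eventually (\<lambda>t. r + c / 2 * (1 - t) * ?D \<le> s) (at_right 0)"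
    using eventually_at_right_less[of 0] eventually_at_right_real[of 0 1, OF zero_less_one]
  proof eventually_elim
    case (elim t)
    have "ereal r \<le> h ((1 - t) *\<^sub>R z + t *\<^sub>R x)"
      using z r by metis
    also have "\<dots> \<le> ereal ((1 - t) * r + t * s - c / 2 * (1 - t) * t * ?D)"
      using elim by (intro strongly_convexD[OF sc r s]) auto
    finally have "t * (r + c / 2 * (1 - t) * ?D) \<le> t * s"
      by (simp add: algebra_simps)
    with elim show ?case by simp
  qed
  ultimately have "r + c / 2 * (1 - 0) * ?D \<le> s"
    by (rule tendsto_upperbound) simp
  then show ?thesis
    by (simp add: norm_minus_commute)
qed

section \<open>The weights of the estimate sequence\<close>

text \<open>The formula for \<open>a\<close> is the positive root of
  \<open>(L - \<mu>f) a\<^sup>2 = (\<gamma> + A \<mu>) a + A \<gamma>\<close>, rearranged here so that the next \<open>\<gamma>\<close> appears. The lower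
  bound comes from the square root being at least \<open>1\<close>; it is what the first step, possibly
  with \<open>A = 0\<close>, relies on.\<close>

lemma trial_a_quadratic:
  assumes "\<mu>f < L" "0 \<le> acc_wt s" "0 < curv s" "0 \<le> \<mu>f + \<mu>\<Psi>"
  defines "a \<equiv> trial_a \<mu>f \<mu>\<Psi> s L"
  shows "(L - \<mu>f) * a\<^sup>2 = acc_wt s * trial_\<gamma> \<mu>f \<mu>\<Psi> s L + a * curv s"
    and "curv s / (L - \<mu>f) \<le> a"
proof -
  define A \<gamma> m b where "A = acc_wt s" and "\<gamma> = curv s" and "m = L - \<mu>f"
    and "b = \<gamma> + A * (\<mu>f + \<mu>\<Psi>)"
  define R where "R = sqrt (1 + 4 * m * A * \<gamma> / b\<^sup>2)"
  have pos: "0 \<le> A" "0 < \<gamma>" "0 < m" "\<gamma> \<le> b"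
    using assms by (auto simp: A_def \<gamma>_def m_def b_def)
  have b: "0 < b"
    using pos by linarith
  have a: "a = b / (2 * m) * (1 + R)"
    by (simp add: a_def trial_a_def Let_def R_def b_def m_def A_def \<gamma>_def)
  have R2: "R\<^sup>2 = 1 + 4 * m * A * \<gamma> / b\<^sup>2"
    unfolding R_def using pos b by (intro real_sqrt_pow2) (simp add: add_nonneg_nonneg)
  have "1 \<le> R"
    unfolding R_def using pos b by simp
  have "\<gamma> / m \<le> b / (2 * m) * (1 + 1)"
    using pos by (simp add: divide_right_mono)
  also have "\<dots> \<le> a"
    unfolding a using pos b \<open>1 \<le> R\<close> by (intro mult_left_mono) auto
  finally show "curv s / (L - \<mu>f) \<le> a"
    by (simp add: \<gamma>_def m_def)
  have "4 * m * (m * a\<^sup>2) = b\<^sup>2 * (1 + 2 * R + R\<^sup>2)"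
    unfolding a using pos by (simp add: power2_eq_square field_simps)
  also have "\<dots> = 2 * b\<^sup>2 * (1 + R) + 4 * m * A * \<gamma>"
    unfolding R2 using b by (simp add: field_simps)
  also have "\<dots> = 4 * m * (b * a + A * \<gamma>)"
    unfolding a using pos by (simp add: power2_eq_square field_simps)
  finally have "m * a\<^sup>2 = b * a + A * \<gamma>"
    using pos by simp
  then show "(L - \<mu>f) * a\<^sup>2 = acc_wt s * trial_\<gamma> \<mu>f \<mu>\<Psi> s L + a * curv s"
    by (simp add: trial_\<gamma>_def b_def m_def A_def \<gamma>_def algebra_simps flip: a_def)
qed

lemma acgm_step_weights:
  assumes "0 \<le> acc_wt s" "0 < curv s" "0 \<le> \<mu>f + \<mu>\<Psi>"
    and s'_eq: "s' = acgm_step monotone_variant f grad_f \<Psi> \<mu>f \<mu>\<Psi> r\<^sub>u r\<^sub>d s"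
    and "\<mu>f < lip s'"
  defines "a \<equiv> acc_wt s' - acc_wt s"
  shows "curv s' = curv s + a * (\<mu>f + \<mu>\<Psi>)"
    and "(lip s' - \<mu>f) * a\<^sup>2 = acc_wt s * curv s' + a * curv s"
    and "curv s / (lip s' - \<mu>f) \<le> a"
proof -
  have s': "a = trial_a \<mu>f \<mu>\<Psi> s (lip s')" "curv s' = trial_\<gamma> \<mu>f \<mu>\<Psi> s (lip s')"
    by (simp_all add: a_def s'_eq acgm_step_def Let_def trial_A_def)
  show "curv s' = curv s + a * (\<mu>f + \<mu>\<Psi>)"
    by (simp add: s' trial_\<gamma>_def)
  show "(lip s' - \<mu>f) * a\<^sup>2 = acc_wt s * curv s' + a * curv s" "curv s / (lip s' - \<mu>f) \<le> a"
    unfolding s' using trial_a_quadratic[of \<mu>f "lip s'" s \<mu>\<Psi>] assms by auto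
qed

text \<open>Since \<open>A' - A = (\<surd>A' - \<surd>A)(\<surd>A' + \<surd>A) \<le> 2 \<surd>A' (\<surd>A' - \<surd>A)\<close>, a lower bound for the
  increment by a multiple of \<open>\<surd>A'\<close> is a constant lower bound for the increment of the root.\<close>

lemma sqrt_weight_growth:
  fixes A A' g N :: real
  assumes "0 \<le> A" "A \<le> A'" "0 < A'" "0 \<le> g" "0 < N" "g * A' \<le> N * (A' - A)\<^sup>2"
  shows "sqrt A + sqrt (g / N) / 2 \<le> sqrt A'"
proof -
  have "sqrt (g / N) * sqrt A' = sqrt (g * A' / N)"
    by (simp add: real_sqrt_mult real_sqrt_divide)
  also have "\<dots> \<le> sqrt ((A' - A)\<^sup>2)"
    using assms by (intro real_sqrt_le_mono) (simp add: field_simps)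
  also have "\<dots> = A' - A"
    using assms by simp
  also have "\<dots> = (sqrt A' - sqrt A) * (sqrt A' + sqrt A)"
    using assms by (simp add: algebra_simps)
  also have "\<dots> \<le> (sqrt A' - sqrt A) * (2 * sqrt A')"
    using assms by (intro mult_left_mono) auto
  finally have "sqrt (g / N) * sqrt A' \<le> (2 * (sqrt A' - sqrt A)) * sqrt A'"
    by (simp add: mult_ac)
  then show ?thesis
    using assms by simp
qed

lemma weight_contraction:
  fixes A A' \<mu> M :: real
  assumes "0 \<le> A" "A \<le> A'" "0 \<le> \<mu>" "0 < M" "\<mu> * A'\<^sup>2 \<le> M * (A' - A)\<^sup>2"
  shows "A \<le> (1 - sqrt (\<mu> / M)) * A'"
proof -
  have "(sqrt (\<mu> / M) * A')\<^sup>2 = \<mu> * A'\<^sup>2 / M"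
    using assms by (simp add: power_mult_distrib)
  also have "\<dots> \<le> (A' - A)\<^sup>2"
    using assms by (simp add: divide_le_eq mult.commute)
  finally have "sqrt (\<mu> / M) * A' \<le> A' - A"
    by (rule power2_le_imp_le) (simp add: assms(2))
  then show ?thesis
    by (simp add: algebra_simps)
qed

section \<open>A Euclidean inequality for the estimate points\<close>

text \<open>Take \<open>y\<close> as the origin and multiply by \<open>\<gamma>'\<close>. The terms linear in \<open>p\<close> and those in
  \<open>\<parallel>p\<parallel>\<^sup>2\<close> cancel by the definition of \<open>v'\<close>; the inner products of \<open>z\<close> with \<open>x\<close> and \<open>v\<close> cancel because
  \<open>y\<close> is the weighted mean of \<open>x\<close> and \<open>v\<close>; the coefficient of \<open>\<parallel>z\<parallel>\<^sup>2\<close> vanishes by the quadratic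
  equation for \<open>a\<close>. What is left is \<open>M - m\<close> times a nonnegative combination of \<open>\<parallel>x\<parallel>\<^sup>2\<close> and
  \<open>\<parallel>v\<parallel>\<^sup>2\<close>. In the application \<open>M = L + \<mu>\<Psi>\<close> and \<open>m = L - \<mu>f\<close>.\<close>

lemma estimate_point_inequality:
  fixes x v y z v' p :: "'a::real_inner"
  assumes \<gamma>': "\<gamma>' = \<gamma> + a * (M - m)" "0 < \<gamma>'"
    and a: "m * a\<^sup>2 = A * \<gamma>' + a * \<gamma>"
    and y: "(A * \<gamma>' + a * \<gamma>) *\<^sub>R y = (A * \<gamma>') *\<^sub>R x + (a * \<gamma>) *\<^sub>R v"
    and v': "\<gamma>' *\<^sub>R v' = \<gamma> *\<^sub>R v + (a * M) *\<^sub>R z - (a * m) *\<^sub>R y"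
    and pos: "0 \<le> A" "0 \<le> a" "0 \<le> \<gamma>" "m \<le> M"
  shows "A * (m * (norm (x - y))\<^sup>2 - M * (norm (x - z))\<^sup>2)
           + a * (m * (norm (p - y))\<^sup>2 - M * (norm (p - z))\<^sup>2)
         \<le> \<gamma> * (norm (v - p))\<^sup>2 - \<gamma>' * (norm (v' - p))\<^sup>2"
proof -
  define X V Z P W where "X = x - y" and "V = v - y" and "Z = z - y" and "P = p - y"
    and "W = v' - y"
  have diffs: "x - y = X" "x - z = X - Z" "p - y = P" "p - z = P - Z" "v - p = V - P" "v' - p = W - P"
    by (simp_all add: X_def V_def Z_def P_def W_def)
  have "(a * \<gamma>) *\<^sub>R V + (A * \<gamma>') *\<^sub>R X = 0"
    using y by (simp add: X_def V_def algebra_simps)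
  then have "((a * \<gamma>) *\<^sub>R V + (A * \<gamma>') *\<^sub>R X) \<bullet> Z = 0"
    by simp
  then have ort: "a * \<gamma> * (V \<bullet> Z) + A * \<gamma>' * (X \<bullet> Z) = 0"
    by (simp add: inner_add_left)
  have "\<gamma>' *\<^sub>R (W - P) = \<gamma> *\<^sub>R V + (a * M) *\<^sub>R Z - \<gamma>' *\<^sub>R P"
  proof -
    have "\<gamma>' *\<^sub>R y = \<gamma> *\<^sub>R y + (a * M) *\<^sub>R y - (a * m) *\<^sub>R y"
      by (simp add: \<gamma>'(1) algebra_simps)
    then have "\<gamma>' *\<^sub>R W = \<gamma> *\<^sub>R V + (a * M) *\<^sub>R Z"
      by (simp add: W_def V_def Z_def scaleR_diff_right v')
    then show ?thesis
      by (simp add: scaleR_diff_right)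
  qed
  then have "(norm (\<gamma>' *\<^sub>R (W - P)))\<^sup>2 = (norm (\<gamma> *\<^sub>R V + (a * M) *\<^sub>R Z - \<gamma>' *\<^sub>R P))\<^sup>2"
    by simp
  then have W: "\<gamma>' * (\<gamma>' * (norm (W - P))\<^sup>2) = (norm (\<gamma> *\<^sub>R V + (a * M) *\<^sub>R Z - \<gamma>' *\<^sub>R P))\<^sup>2"
    by (simp add: power_mult_distrib power2_eq_square[of \<gamma>'] mult.assoc)
  let ?l = "A * (m * (norm X)\<^sup>2 - M * (norm (X - Z))\<^sup>2) + a * (m * (norm P)\<^sup>2 - M * (norm (P - Z))\<^sup>2)"
  let ?r = "\<gamma> * (norm (V - P))\<^sup>2 - \<gamma>' * (norm (W - P))\<^sup>2"
  have sqs: "(norm (X - Z))\<^sup>2 = X \<bullet> X - 2 * (X \<bullet> Z) + Z \<bullet> Z"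
    "(norm (P - Z))\<^sup>2 = P \<bullet> P - 2 * (P \<bullet> Z) + Z \<bullet> Z"
    "(norm (V - P))\<^sup>2 = V \<bullet> V - 2 * (V \<bullet> P) + P \<bullet> P"
    "(norm X)\<^sup>2 = X \<bullet> X" "(norm P)\<^sup>2 = P \<bullet> P"
    "(norm (\<gamma> *\<^sub>R V + (a * M) *\<^sub>R Z - \<gamma>' *\<^sub>R P))\<^sup>2 =
       \<gamma>\<^sup>2 * (V \<bullet> V) + (a * M)\<^sup>2 * (Z \<bullet> Z) + \<gamma>'\<^sup>2 * (P \<bullet> P) + 2 * \<gamma> * (a * M) * (V \<bullet> Z)
         - 2 * \<gamma> * \<gamma>' * (V \<bullet> P) - 2 * (a * M) * \<gamma>' * (P \<bullet> Z)"
    by (simp_all only: power2_norm_eq_inner)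
       (simp_all add: inner_add_left inner_add_right inner_diff_left inner_diff_right inner_commute
          algebra_simps power2_eq_square)
  have "\<gamma>' * (?r - ?l) = \<gamma>' * \<gamma> * (norm (V - P))\<^sup>2
      - (norm (\<gamma> *\<^sub>R V + (a * M) *\<^sub>R Z - \<gamma>' *\<^sub>R P))\<^sup>2 - \<gamma>' * ?l"
    unfolding W[symmetric] by (simp add: algebra_simps)
  also have "\<dots> = (M - m) * (a * \<gamma> * (V \<bullet> V) + A * \<gamma>' * (X \<bullet> X))
      - 2 * M * (a * \<gamma> * (V \<bullet> Z) + A * \<gamma>' * (X \<bullet> Z)) + M * (A * \<gamma>' + a * \<gamma> - m * a\<^sup>2) * (Z \<bullet> Z)"
    unfolding sqs unfolding \<gamma>'(1) by (simp add: algebra_simps power2_eq_square)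
  also have "\<dots> = (M - m) * (a * \<gamma> * (V \<bullet> V) + A * \<gamma>' * (X \<bullet> X))"
    by (simp add: ort a)
  also have "\<dots> \<ge> 0"
    using pos \<gamma>'(2) by simp
  finally have "0 \<le> ?r - ?l"
    using \<gamma>'(2) by (simp add: zero_le_mult_iff)
  then show ?thesis
    unfolding diffs by simp
qed

section \<open>One step of the algorithm\<close>

locale composite_problem =
  fixes f :: "'a::euclidean_space \<Rightarrow> real" and grad_f :: "'a \<Rightarrow> 'a" and \<Psi> :: "'a \<Rightarrow> ereal"
    and L\<^sub>f \<mu>f \<mu>\<Psi> :: real and xstar :: 'a
  assumes deriv: "\<And>p. GDERIV f p :> grad_f p"
    and lip: "L\<^sub>f-lipschitz_on UNIV grad_f"
    and \<mu>f_nonneg: "0 \<le> \<mu>f"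
    and f_convex: "convex_on UNIV (\<lambda>p. f p - \<mu>f / 2 * (norm p)\<^sup>2)"
    and \<Psi>_not_MInf: "\<And>p. \<Psi> p \<noteq> -\<infinity>"
    and \<Psi>_proper: "\<exists>p. \<Psi> p \<noteq> \<infinity>"
    and \<Psi>_lsc: "lower_semicontinuous \<Psi>"
    and \<mu>\<Psi>_nonneg: "0 \<le> \<mu>\<Psi>"
    and \<Psi>_convex: "ereal_convex (\<lambda>p. \<Psi> p - ereal (\<mu>\<Psi> / 2 * (norm p)\<^sup>2))"
    and xstar: "is_arg_min (objective f \<Psi>) (\<lambda>_. True) xstar"
begin

abbreviation F :: "'a \<Rightarrow> ereal" where
  "F \<equiv> objective f \<Psi>"

text \<open>At infeasible points this is \<open>real_of_ereal \<infinity> = 0\<close>. The value is harmless: the gap of an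
  infeasible point enters the potential multiplied by a weight \<open>A = 0\<close>.\<close>

definition gap :: "'a \<Rightarrow> real" where
  "gap p = real_of_ereal (F p - F xstar)"

lemma F_not_MInf: "F p \<noteq> -\<infinity>"
  using \<Psi>_not_MInf[of p] by (cases "\<Psi> p") (auto simp: objective_def)

lemma F_xstar_le: "F xstar \<le> F p"
  using xstar by (simp add: is_arg_min_linorder)

lemma F_xstar_finite: "F xstar \<noteq> \<infinity>"
proof -
  obtain p where "\<Psi> p \<noteq> \<infinity>"
    using \<Psi>_proper by auto
  then have "F p \<noteq> \<infinity>"
    by (simp add: objective_def)
  with F_xstar_le[of p] show ?thesis
    by auto
qed

lemma gap_eq:
  assumes "F p \<noteq> \<infinity>"
  shows "F p - F xstar = ereal (gap p)"
  using assms F_not_MInf[of p] F_not_MInf[of xstar] F_xstar_finite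
  by (cases "F p"; cases "F xstar") (auto simp: gap_def)

lemma gap_xstar: "gap xstar = 0"
  using F_not_MInf[of xstar] F_xstar_finite by (cases "F xstar") (auto simp: gap_def)

lemma gap_mono:
  assumes "F p \<le> F q" "F q \<noteq> \<infinity>"
  shows "gap p \<le> gap q"
  using assms F_not_MInf[of p] F_not_MInf[of q] F_not_MInf[of xstar] F_xstar_finite
  by (cases "F p"; cases "F q"; cases "F xstar") (auto simp: gap_def)

lemma gap_nonneg: "0 \<le> gap p"
proof (cases "F p = \<infinity>")
  case True
  then show ?thesis
    using F_xstar_finite F_not_MInf[of xstar] by (cases "F xstar") (auto simp: gap_def)
next
  case False
  then show ?thesis
    using gap_mono[OF F_xstar_le False] by (simp add: gap_xstar)
qed

lemma prox_grad_minimizes: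
  assumes "0 < L"
  shows "ereal (quad_model f grad_f L y (prox_grad f grad_f \<Psi> L y)) + \<Psi> (prox_grad f grad_f \<Psi> L y)
           \<le> ereal (quad_model f grad_f L y w) + \<Psi> w"
proof -
  let ?h = "\<lambda>x. ereal (quad_model f grad_f L y x) + \<Psi> x"
  obtain p where p: "\<Psi> p \<noteq> \<infinity>"
    using \<Psi>_proper by auto
  have h: "strongly_convex (L + \<mu>\<Psi>) ?h"
    by (intro strongly_convex_quad_model_plus strongly_convexI_ereal_convex \<Psi>_convex)
  have lsc: "lower_semicontinuous ?h"
    using \<Psi>_lsc \<Psi>_not_MInf unfolding quad_model_def
    by (intro lower_semicontinuous_add_continuous continuous_intros)
  have minf: "?h x \<noteq> -\<infinity>" for x
    using \<Psi>_not_MInf[of x] by (cases "\<Psi> x") auto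
  obtain z where z: "\<And>w. ?h z \<le> ?h w"
    using strongly_convex_min_exists[OF h _ lsc minf, of p] assms \<mu>\<Psi>_nonneg p by auto
  have "is_arg_min ?h (\<lambda>_. True) (prox_grad f grad_f \<Psi> L y)"
    unfolding prox_grad_def arg_min_def
    by (rule someI[of _ z]) (use z in \<open>simp add: is_arg_min_linorder\<close>)
  then show ?thesis
    by (simp add: is_arg_min_linorder)
qed

text \<open>The single inequality through which the step enters the analysis: quadratic growth of the
  model at \<open>z\<close> on the left, acceptance at \<open>z\<close>, and strong convexity of \<open>f\<close> at \<open>x\<close> on the
  right.\<close>

lemma prox_grad_gap_inequality:
  assumes "0 < L" and z: "z = prox_grad f grad_f \<Psi> L y"
    and acc: "f z \<le> quad_model f grad_f L y z"
    and x: "F x \<noteq> \<infinity>"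
  shows "F z \<noteq> \<infinity>"
    and "gap z + (L + \<mu>\<Psi>) / 2 * (norm (x - z))\<^sup>2 \<le> gap x + (L - \<mu>f) / 2 * (norm (x - y))\<^sup>2"
proof -
  let ?h = "\<lambda>x. ereal (quad_model f grad_f L y x) + \<Psi> x"
  have h: "strongly_convex (L + \<mu>\<Psi>) ?h"
    by (intro strongly_convex_quad_model_plus strongly_convexI_ereal_convex \<Psi>_convex)
  have min: "?h z \<le> ?h w" for w
    unfolding z by (rule prox_grad_minimizes[OF \<open>0 < L\<close>])
  obtain \<psi>x where x': "\<Psi> x = ereal \<psi>x"
    using x \<Psi>_not_MInf[of x] by (cases "\<Psi> x") (auto simp: objective_def)
  obtain \<psi>z where z': "\<Psi> z = ereal \<psi>z"
    using min[of x] x' \<Psi>_not_MInf[of z] by (cases "\<Psi> z") auto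
  show "F z \<noteq> \<infinity>"
    using z' by (simp add: objective_def)
  have "quad_model f grad_f L y z + \<psi>z + (L + \<mu>\<Psi>) / 2 * (norm (x - z))\<^sup>2
      \<le> quad_model f grad_f L y x + \<psi>x"
    by (rule strongly_convex_min_growth[OF h min]) (auto simp: x' z')
  moreover have "quad_model f grad_f L y x \<le> f x + (L - \<mu>f) / 2 * (norm (x - y))\<^sup>2"
    using strongly_convex_above_quad_model[OF deriv f_convex, of y x]
    by (simp add: quad_model_def algebra_simps diff_divide_distrib)
  ultimately have "f z + \<psi>z + (L + \<mu>\<Psi>) / 2 * (norm (x - z))\<^sup>2
      \<le> f x + \<psi>x + (L - \<mu>f) / 2 * (norm (x - y))\<^sup>2"
    using acc by linarith
  moreover obtain \<phi> where "F xstar = ereal \<phi>"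
    using F_not_MInf[of xstar] F_xstar_finite by (cases "F xstar") auto
  ultimately show "gap z + (L + \<mu>\<Psi>) / 2 * (norm (x - z))\<^sup>2
      \<le> gap x + (L - \<mu>f) / 2 * (norm (x - y))\<^sup>2"
    by (simp add: gap_def objective_def[of f \<Psi> x] objective_def[of f \<Psi> z] x' z')
qed

definition potential :: "'a acgm_state \<Rightarrow> real" where
  "potential s = acc_wt s * gap (main_pt s) + curv s / 2 * (norm (est_pt s - xstar))\<^sup>2"

lemma lipschitz_imp_accepted:
  assumes "L\<^sub>f \<le> L"
  shows "accepted f grad_f \<Psi> \<mu>f \<mu>\<Psi> s L"
proof -
  let ?y = "trial_y \<mu>f \<mu>\<Psi> s L" and ?z = "trial_z f grad_f \<Psi> \<mu>f \<mu>\<Psi> s L"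
  have "f ?z \<le> quad_model f grad_f L\<^sub>f ?y ?z"
    by (rule descent_lemma[OF deriv lip])
  also have "\<dots> \<le> quad_model f grad_f L ?y ?z"
    using assms by (auto simp: quad_model_def intro!: mult_right_mono)
  finally show ?thesis
    by (simp add: accepted_def)
qed

text \<open>The trial values grow geometrically past \<open>L\<^sub>f\<close>, so some trial is accepted and
  the least index is a true minimum. If the first trial fails, the last rejected one was at
  most \<open>L\<^sub>f\<close>, and the accepted one is \<open>r\<^sub>u\<close> times as large.\<close>

lemma backtracking_terminates:
  assumes ru: "1 < r\<^sub>u" and rd: "0 < r\<^sub>d" and s: "0 < lip s"
  defines "L \<equiv> trial_L r\<^sub>u r\<^sub>d s (rejections f grad_f \<Psi> \<mu>f \<mu>\<Psi> r\<^sub>u r\<^sub>d s)"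
  shows "accepted f grad_f \<Psi> \<mu>f \<mu>\<Psi> s L" and "L \<le> max (r\<^sub>u * L\<^sub>f) (r\<^sub>d * lip s)"
proof -
  define P where "P j \<longleftrightarrow> accepted f grad_f \<Psi> \<mu>f \<mu>\<Psi> s (trial_L r\<^sub>u r\<^sub>d s j)" for j
  have R: "rejections f grad_f \<Psi> \<mu>f \<mu>\<Psi> r\<^sub>u r\<^sub>d s = (LEAST j. P j)"
    by (simp add: rejections_def P_def)
  obtain n where "L\<^sub>f / (r\<^sub>d * lip s) < r\<^sub>u ^ n"
    using real_arch_pow[OF ru] by blast
  then have "L\<^sub>f \<le> trial_L r\<^sub>u r\<^sub>d s n"
    using rd s by (simp add: trial_L_def field_simps)
  then have "P n"
    unfolding P_def by (rule lipschitz_imp_accepted)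
  then have "P (LEAST j. P j)"
    by (rule LeastI)
  then show "accepted f grad_f \<Psi> \<mu>f \<mu>\<Psi> s L"
    by (simp add: P_def R L_def)
  show "L \<le> max (r\<^sub>u * L\<^sub>f) (r\<^sub>d * lip s)"
  proof (cases "LEAST j. P j")
    case 0
    then show ?thesis by (simp add: L_def R trial_L_def)
  next
    case (Suc j)
    then have "\<not> P j"
      using not_less_Least[of j P] by simp
    then have "trial_L r\<^sub>u r\<^sub>d s j \<le> L\<^sub>f"
      unfolding P_def by (meson lipschitz_imp_accepted linear)
    then have "r\<^sub>u * trial_L r\<^sub>u r\<^sub>d s j \<le> r\<^sub>u * L\<^sub>f"
      using ru by (intro mult_left_mono) auto
    moreover have "L = r\<^sub>u * trial_L r\<^sub>u r\<^sub>d s j"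
      by (simp add: L_def R Suc trial_L_def mult_ac)
    ultimately show ?thesis by simp
  qed
qed

text \<open>The gap inequality with weight \<open>A\<close> at \<open>x\<close> and weight \<open>a\<close> at \<open>xstar\<close>, added to the
  Euclidean inequality. Both variants are covered at once, as the new main point is never
  worse than \<open>z\<close>.\<close>

lemma acgm_step_potential:
  fixes monotone_variant :: bool
  assumes ru: "1 < r\<^sub>u" and rd: "0 < r\<^sub>d" and lip_pos: "0 < lip s"
    and A: "0 \<le> acc_wt s" and \<gamma>: "0 < curv s" and feas: "0 < acc_wt s \<Longrightarrow> F (main_pt s) \<noteq> \<infinity>"
  defines "s' \<equiv> acgm_step monotone_variant f grad_f \<Psi> \<mu>f \<mu>\<Psi> r\<^sub>u r\<^sub>d s"
  assumes L: "\<mu>f < lip s'"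
  shows "F (main_pt s') \<noteq> \<infinity>" and "potential s' \<le> potential s"
proof -
  define l where "l = trial_L r\<^sub>u r\<^sub>d s (rejections f grad_f \<Psi> \<mu>f \<mu>\<Psi> r\<^sub>u r\<^sub>d s)"
  define a where "a = trial_a \<mu>f \<mu>\<Psi> s l"
  define \<gamma>' where "\<gamma>' = trial_\<gamma> \<mu>f \<mu>\<Psi> s l"
  define y where "y = trial_y \<mu>f \<mu>\<Psi> s l"
  define z where "z = trial_z f grad_f \<Psi> \<mu>f \<mu>\<Psi> s l"
  define x where "x = main_pt s"
  define v where "v = est_pt s"
  define v' where "v' = est_pt s'"
  define A where "A = acc_wt s"
  define \<gamma> where "\<gamma> = curv s"
  have s': "lip s' = l" "acc_wt s' = A + a" "curv s' = \<gamma>'"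
    "main_pt s' = (if monotone_variant \<and> \<not> F z \<le> F x then x else z)"
    "v' = (1 / \<gamma>') *\<^sub>R (\<gamma> *\<^sub>R v + (a * (l + \<mu>\<Psi>)) *\<^sub>R z - (a * (l - \<mu>f)) *\<^sub>R y)"
    by (simp_all add: s'_def acgm_step_def Let_def l_def a_def \<gamma>'_def y_def z_def x_def v_def v'_def
        A_def \<gamma>_def trial_A_def)
  have l: "\<mu>f < l" "0 < l"
    using L s'(1) \<mu>f_nonneg by auto
  have pos: "0 \<le> A" "0 < \<gamma>"
    using assms by (auto simp: A_def \<gamma>_def)
  have quadratic: "(l - \<mu>f) * a\<^sup>2 = A * \<gamma>' + a * \<gamma>" and "\<gamma> / (l - \<mu>f) \<le> a"
    using trial_a_quadratic[of \<mu>f l s \<mu>\<Psi>] l pos \<mu>f_nonneg \<mu>\<Psi>_nonneg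
    by (auto simp: a_def \<gamma>'_def A_def \<gamma>_def)
  moreover have "0 < \<gamma> / (l - \<mu>f)"
    using l pos by simp
  ultimately have "0 < a" by linarith
  have \<gamma>': "\<gamma>' = \<gamma> + a * (\<mu>f + \<mu>\<Psi>)"
    by (simp add: \<gamma>'_def trial_\<gamma>_def a_def \<gamma>_def)
  have "0 < \<gamma>'"
    using \<gamma>' pos \<open>0 < a\<close> \<mu>f_nonneg \<mu>\<Psi>_nonneg by (simp add: add_pos_nonneg)
  have "0 < A * \<gamma>' + a * \<gamma>"
    using pos \<open>0 < a\<close> \<open>0 < \<gamma>'\<close> by (intro add_nonneg_pos) auto
  then have y: "(A * \<gamma>' + a * \<gamma>) *\<^sub>R y = (A * \<gamma>') *\<^sub>R x + (a * \<gamma>) *\<^sub>R v"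
    by (simp add: y_def trial_y_def Let_def a_def \<gamma>'_def x_def v_def A_def \<gamma>_def)
  have z: "z = prox_grad f grad_f \<Psi> l y"
    by (simp add: z_def y_def trial_z_def)
  have acc: "f z \<le> quad_model f grad_f l y z"
    using backtracking_terminates(1)[where s=s, OF ru rd lip_pos] by (simp add: accepted_def z_def y_def l_def)
  note ineq = prox_grad_gap_inequality[OF l(2) z acc]
  have Fz: "F z \<noteq> \<infinity>"
    using ineq(1) F_xstar_finite by blast
  then show "F (main_pt s') \<noteq> \<infinity>"
    unfolding s'(4) by auto
  have "gap (main_pt s') \<le> gap z"
    unfolding s'(4) using gap_mono[of x z] Fz by auto
  define M m where "M = l + \<mu>\<Psi>" and "m = l - \<mu>f"
  have "A * (gap z + M / 2 * (norm (x - z))\<^sup>2) \<le> A * (gap x + m / 2 * (norm (x - y))\<^sup>2)"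
  \<comment> \<open>For \<open>A = 0\<close> the point \<open>x\<close> may be infeasible, and both sides vanish.\<close>
  proof (cases "A = 0")
    case False
    with feas pos have "F x \<noteq> \<infinity>"
      by (auto simp: A_def x_def)
    then show ?thesis
      using ineq(2) pos unfolding M_def m_def by (intro mult_left_mono)
  qed simp
  moreover have "a * (gap z + M / 2 * (norm (xstar - z))\<^sup>2)
      \<le> a * (m / 2 * (norm (xstar - y))\<^sup>2)"
    using ineq(2)[OF F_xstar_finite] \<open>0 < a\<close> unfolding M_def m_def
    by (intro mult_left_mono) (auto simp: gap_xstar)
  moreover have "(A + a) * gap (main_pt s') \<le> (A + a) * gap z"
    using \<open>gap (main_pt s') \<le> gap z\<close> pos \<open>0 < a\<close> by (intro mult_left_mono) auto
  moreover have "A * (m * (norm (x - y))\<^sup>2 - M * (norm (x - z))\<^sup>2)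
      + a * (m * (norm (xstar - y))\<^sup>2 - M * (norm (xstar - z))\<^sup>2)
      \<le> \<gamma> * (norm (v - xstar))\<^sup>2 - \<gamma>' * (norm (v' - xstar))\<^sup>2"
    using \<gamma>' \<open>0 < \<gamma>'\<close> quadratic y s'(5) pos \<open>0 < a\<close> \<mu>f_nonneg \<mu>\<Psi>_nonneg
    unfolding M_def m_def by (intro estimate_point_inequality) auto
  ultimately show "potential s' \<le> potential s"
    unfolding potential_def s'(2,3) v'_def[symmetric] x_def[symmetric] v_def[symmetric]
      A_def[symmetric] \<gamma>_def[symmetric]
    by (simp add: algebra_simps add_divide_distrib diff_divide_distrib)
qed

end

section \<open>Convergence rates along a run\<close>

locale acgm_run = composite_problem +
  fixes monotone_variant :: bool and r\<^sub>u r\<^sub>d L\<^sub>0 A\<^sub>0 \<gamma>\<^sub>0 :: real and x\<^sub>0 :: 'a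
    and s :: "nat \<Rightarrow> 'a acgm_state" and L\<^sub>u :: real
  assumes L\<^sub>0: "0 < L\<^sub>0" and A\<^sub>0: "0 \<le> A\<^sub>0" and \<gamma>\<^sub>0: "0 < \<gamma>\<^sub>0" "A\<^sub>0 * (\<mu>f + \<mu>\<Psi>) \<le> \<gamma>\<^sub>0"
    and r\<^sub>u: "1 < r\<^sub>u" and r\<^sub>d: "0 < r\<^sub>d" "r\<^sub>d < 1"
    and feasible: "0 < A\<^sub>0 \<Longrightarrow> F x\<^sub>0 < \<infinity>"
    and s_eq: "s = acgm monotone_variant f grad_f \<Psi> \<mu>f \<mu>\<Psi> r\<^sub>u r\<^sub>d L\<^sub>0 A\<^sub>0 \<gamma>\<^sub>0 x\<^sub>0"
    and L_gt: "\<And>k. \<mu>f < lip (s (Suc k))"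
    and L\<^sub>u_eq: "L\<^sub>u = max (r\<^sub>u * L\<^sub>f) (r\<^sub>d * L\<^sub>0)"
begin

lemma s_Suc: "s (Suc k) = acgm_step monotone_variant f grad_f \<Psi> \<mu>f \<mu>\<Psi> r\<^sub>u r\<^sub>d (s k)"
  by (simp add: s_eq)

lemma lip_le:
  shows "0 < lip (s k)" and "lip (s (Suc k)) \<le> L\<^sub>u"
proof -
  show pos: "0 < lip (s k)" for k
    using L_gt[of "k - 1"] \<mu>f_nonneg L\<^sub>0 by (cases k) (auto simp: s_eq)
  have step: "lip (s (Suc k)) \<le> max (r\<^sub>u * L\<^sub>f) (r\<^sub>d * lip (s k))" for k
    using backtracking_terminates(2)[OF r\<^sub>u r\<^sub>d(1) pos, of k]
    by (simp add: s_Suc acgm_step_def Let_def)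
  show "lip (s (Suc k)) \<le> L\<^sub>u"
  proof (induction k)
    case 0
    then show ?case
      using step[of 0] by (simp add: s_eq L\<^sub>u_eq)
  next
    case (Suc k)
    have "r\<^sub>d * lip (s (Suc k)) \<le> 1 * lip (s (Suc k))"
      using r\<^sub>d pos[of "Suc k"] by (intro mult_right_mono) auto
    then show ?case
      using step[of "Suc k"] Suc by (auto simp: L\<^sub>u_eq)
  qed
qed

lemma L\<^sub>u_gt: "\<mu>f < L\<^sub>u"
  using L_gt[of 0] lip_le(2)[of 0] by simp

text \<open>The third line is where \<open>\<gamma>\<^sub>0 \<ge> A\<^sub>0 \<mu>\<close> is used: a step adds \<open>a \<mu>\<close> to both sides.\<close>

lemma run_invariant:
  "0 \<le> acc_wt (s k)" (is ?A)
  "\<gamma>\<^sub>0 \<le> curv (s k)" (is ?B)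
  "acc_wt (s k) * (\<mu>f + \<mu>\<Psi>) \<le> curv (s k)" (is ?C)
  "0 < acc_wt (s k) \<Longrightarrow> F (main_pt (s k)) \<noteq> \<infinity>" (is "_ \<Longrightarrow> ?D")
  "potential (s k) \<le> potential (s 0)" (is ?E)
proof -
  have "?A \<and> ?B \<and> ?C \<and> (0 < acc_wt (s k) \<longrightarrow> ?D) \<and> ?E"
  proof (induction k)
    case 0
    then show ?case
      using A\<^sub>0 \<gamma>\<^sub>0 feasible by (auto simp: s_eq)
  next
    case (Suc k)
    then have pos: "0 \<le> acc_wt (s k)" "0 < curv (s k)"
      using \<gamma>\<^sub>0 by auto
    let ?a = "acc_wt (s (Suc k)) - acc_wt (s k)"
    have curv: "curv (s (Suc k)) = curv (s k) + ?a * (\<mu>f + \<mu>\<Psi>)"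
      and "curv (s k) / (lip (s (Suc k)) - \<mu>f) \<le> ?a"
      using acgm_step_weights(1,3)[OF pos _ s_Suc L_gt] \<mu>f_nonneg \<mu>\<Psi>_nonneg by auto
    moreover have "0 \<le> curv (s k) / (lip (s (Suc k)) - \<mu>f)"
      using pos L_gt[of k] by simp
    ultimately have a: "0 \<le> ?a"
      by linarith
    then have "0 \<le> ?a * (\<mu>f + \<mu>\<Psi>)"
      using \<mu>f_nonneg \<mu>\<Psi>_nonneg by simp
    moreover have "F (main_pt (s (Suc k))) \<noteq> \<infinity>" "potential (s (Suc k)) \<le> potential (s k)"
      using acgm_step_potential[OF r\<^sub>u r\<^sub>d(1) lip_le(1) pos] Suc L_gt[of k]
      by (auto simp: s_Suc)
    ultimately show ?case
      using Suc curv a pos by (auto simp: algebra_simps)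
  qed
  then show ?A ?B ?C ?E and "0 < acc_wt (s k) \<Longrightarrow> ?D"
    by auto
qed

text \<open>The inequalities for \<open>a = A' - A\<close> behind the first step, the quadratic rate and the
  geometric rate, in that order. The accepted value is replaced by its bound \<open>L\<^sub>u\<close> so that all steps
  share the same constants.\<close>

lemma weight_step:
  fixes k :: nat
  defines "A \<equiv> acc_wt (s k)" and "A' \<equiv> acc_wt (s (Suc k))"
  shows "\<gamma>\<^sub>0 / (L\<^sub>u - \<mu>f) \<le> A' - A"
    and "\<gamma>\<^sub>0 * A' \<le> (L\<^sub>u - \<mu>f) * (A' - A)\<^sup>2"
    and "(\<mu>f + \<mu>\<Psi>) * A'\<^sup>2 \<le> (L\<^sub>u + \<mu>\<Psi>) * (A' - A)\<^sup>2"
proof -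
  define \<gamma> where "\<gamma> = curv (s k)"
  define \<gamma>' where "\<gamma>' = curv (s (Suc k))"
  define l where "l = lip (s (Suc k))"
  have inv: "0 \<le> A" "\<gamma>\<^sub>0 \<le> \<gamma>" "0 < \<gamma>" "A' * (\<mu>f + \<mu>\<Psi>) \<le> \<gamma>'" "\<mu>f < l" "l \<le> L\<^sub>u"
    using run_invariant[of k] run_invariant(3)[of "Suc k"] \<gamma>\<^sub>0 L_gt[of k] lip_le(2)[of k]
    unfolding A_def A'_def \<gamma>_def \<gamma>'_def l_def by linarith+
  have step: "\<gamma>' = \<gamma> + (A' - A) * (\<mu>f + \<mu>\<Psi>)" "(l - \<mu>f) * (A' - A)\<^sup>2 = A * \<gamma>' + (A' - A) * \<gamma>"
    "\<gamma> / (l - \<mu>f) \<le> A' - A"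
    using acgm_step_weights[OF _ _ _ s_Suc L_gt, of k] inv \<mu>f_nonneg \<mu>\<Psi>_nonneg
    by (auto simp: A_def A'_def \<gamma>_def \<gamma>'_def l_def)
  have "\<gamma>\<^sub>0 / (L\<^sub>u - \<mu>f) \<le> \<gamma> / (l - \<mu>f)"
    using inv \<gamma>\<^sub>0 by (intro frac_le) auto
  with step(3) show 1: "\<gamma>\<^sub>0 / (L\<^sub>u - \<mu>f) \<le> A' - A"
    by simp
  moreover have "0 < \<gamma>\<^sub>0 / (L\<^sub>u - \<mu>f)"
    using L\<^sub>u_gt \<gamma>\<^sub>0 by simp
  ultimately have "A < A'"
    by linarith
  have "\<gamma>\<^sub>0 * A' \<le> \<gamma> * A'"
    using inv \<open>A < A'\<close> by (intro mult_right_mono) auto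
  also have "\<gamma> * A' = A * \<gamma> + (A' - A) * \<gamma>"
    by (simp add: algebra_simps)
  also have "\<dots> \<le> A * \<gamma>' + (A' - A) * \<gamma>"
    using inv \<open>A < A'\<close> \<mu>f_nonneg \<mu>\<Psi>_nonneg step(1) by (intro add_right_mono mult_left_mono) auto
  also have "\<dots> \<le> (L\<^sub>u - \<mu>f) * (A' - A)\<^sup>2"
    unfolding step(2)[symmetric] using inv by (intro mult_right_mono) auto
  finally show "\<gamma>\<^sub>0 * A' \<le> (L\<^sub>u - \<mu>f) * (A' - A)\<^sup>2" .
  have "(\<mu>f + \<mu>\<Psi>) * A'\<^sup>2 = A' * (A' * (\<mu>f + \<mu>\<Psi>))"
    by (simp add: power2_eq_square)
  also have "\<dots> \<le> A' * \<gamma>'"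
    using inv \<open>A < A'\<close> by (intro mult_left_mono) auto
  also have "\<dots> = (l + \<mu>\<Psi>) * (A' - A)\<^sup>2"
  proof -
    have "(l + \<mu>\<Psi>) * (A' - A)\<^sup>2 = (l - \<mu>f) * (A' - A)\<^sup>2 + (\<mu>f + \<mu>\<Psi>) * (A' - A)\<^sup>2"
      by (simp add: algebra_simps)
    then show ?thesis
      unfolding step(2) step(1) by (simp add: algebra_simps power2_eq_square)
  qed
  also have "\<dots> \<le> (L\<^sub>u + \<mu>\<Psi>) * (A' - A)\<^sup>2"
    using inv by (intro mult_right_mono) auto
  finally show "(\<mu>f + \<mu>\<Psi>) * A'\<^sup>2 \<le> (L\<^sub>u + \<mu>\<Psi>) * (A' - A)\<^sup>2" .
qed

lemma acc_wt_strict_mono: "acc_wt (s k) < acc_wt (s (Suc k))"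
proof -
  have "0 < \<gamma>\<^sub>0 / (L\<^sub>u - \<mu>f)"
    using L\<^sub>u_gt \<gamma>\<^sub>0 by simp
  with weight_step(1)[of k] show ?thesis
    by linarith
qed

lemma acc_wt_quadratic_growth:
  "\<gamma>\<^sub>0 / (L\<^sub>u - \<mu>f) \<le> 4 / (real (Suc k) + 1)\<^sup>2 * acc_wt (s (Suc k))"
proof -
  define g where "g = \<gamma>\<^sub>0 / (L\<^sub>u - \<mu>f)"
  have "0 < g"
    using L\<^sub>u_gt \<gamma>\<^sub>0 by (simp add: g_def)
  have "(real (Suc k) + 1) / 2 * sqrt g \<le> sqrt (acc_wt (s (Suc k)))"
  proof (induction k)
    case 0
    show ?case
      using weight_step(1)[of 0] run_invariant(1)[of 0] by (simp flip: g_def)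
  next
    case (Suc k)
    have "sqrt (acc_wt (s (Suc k))) + sqrt g / 2 \<le> sqrt (acc_wt (s (Suc (Suc k))))"
      using weight_step(2)[of "Suc k"] acc_wt_strict_mono[of "Suc k"] run_invariant(1)[of "Suc k"]
        L\<^sub>u_gt \<gamma>\<^sub>0
      unfolding g_def by (intro sqrt_weight_growth) auto
    with Suc show ?case
      by (simp add: field_simps)
  qed
  then have "((real (Suc k) + 1) / 2 * sqrt g)\<^sup>2 \<le> (sqrt (acc_wt (s (Suc k))))\<^sup>2"
    using \<open>0 < g\<close> by (intro power_mono) auto
  then have "(real (Suc k) + 1)\<^sup>2 / 4 * g \<le> acc_wt (s (Suc k))"
    using \<open>0 < g\<close> run_invariant(1)[of "Suc k"]
    by (simp add: power_mult_distrib power_divide del: of_nat_Suc)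
  then show ?thesis
    by (simp add: pos_le_divide_eq mult.commute del: of_nat_Suc flip: g_def)
qed

lemma acc_wt_geometric_growth:
  "\<gamma>\<^sub>0 / (L\<^sub>u - \<mu>f) \<le> (1 - sqrt ((\<mu>f + \<mu>\<Psi>) / (L\<^sub>u + \<mu>\<Psi>))) ^ k * acc_wt (s (Suc k))"
proof (induction k)
  case 0
  show ?case
    using weight_step(1)[of 0] run_invariant(1)[of 0] by simp
next
  case (Suc k)
  let ?\<rho> = "1 - sqrt ((\<mu>f + \<mu>\<Psi>) / (L\<^sub>u + \<mu>\<Psi>))"
  have "0 \<le> ?\<rho>"
    using L\<^sub>u_gt \<mu>f_nonneg \<mu>\<Psi>_nonneg by simp
  moreover have "acc_wt (s (Suc k)) \<le> ?\<rho> * acc_wt (s (Suc (Suc k)))"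
    using weight_step(3)[of "Suc k"] acc_wt_strict_mono[of "Suc k"] run_invariant(1)[of "Suc k"]
      L\<^sub>u_gt \<mu>f_nonneg \<mu>\<Psi>_nonneg
    by (intro weight_contraction) auto
  ultimately have "?\<rho> ^ k * acc_wt (s (Suc k)) \<le> ?\<rho> ^ k * (?\<rho> * acc_wt (s (Suc (Suc k))))"
    by (intro mult_left_mono) auto
  with Suc show ?case
    by (simp add: mult_ac)
qed

text \<open>Any lower bound on \<open>A\<^sub>k\<close> becomes an upper bound on the gap through
  \<open>A\<^sub>k gap(x\<^sub>k) \<le> \<gamma>\<^sub>0 \<Delta>\<^sub>0\<close>.\<close>

lemma gap_bound:
  assumes "\<gamma>\<^sub>0 / (L\<^sub>u - \<mu>f) \<le> c * acc_wt (s (Suc k))"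
  shows "gap (main_pt (s (Suc k)))
           \<le> c * (L\<^sub>u - \<mu>f) * (A\<^sub>0 / \<gamma>\<^sub>0 * gap x\<^sub>0 + 1 / 2 * (norm (x\<^sub>0 - xstar))\<^sup>2)"
    (is "?gap \<le> c * ?N * ?\<Delta>")
proof -
  let ?A = "acc_wt (s (Suc k))"
  have A: "0 < ?A"
    using acc_wt_strict_mono[of k] run_invariant(1)[of k] by simp
  have "0 \<le> ?\<Delta>"
    using A\<^sub>0 \<gamma>\<^sub>0 gap_nonneg by simp
  have "?A * ?gap \<le> potential (s (Suc k))"
    using run_invariant(2)[of "Suc k"] \<gamma>\<^sub>0 by (simp add: potential_def)
  also have "\<dots> \<le> potential (s 0)"
    by (rule run_invariant)
  also have "\<dots> = \<gamma>\<^sub>0 * ?\<Delta>"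
    using \<gamma>\<^sub>0 by (simp add: potential_def s_eq distrib_left)
  also have "\<dots> \<le> (c * ?A * ?N) * ?\<Delta>"
    using assms L\<^sub>u_gt \<open>0 \<le> ?\<Delta>\<close> by (intro mult_right_mono) (auto simp: pos_divide_le_eq)
  finally have "?A * ?gap \<le> ?A * (c * ?N * ?\<Delta>)"
    by (simp add: mult_ac)
  with A show ?thesis
    by (simp only: mult_le_cancel_left_pos)
qed

lemma F_bound:
  assumes "1 \<le> k"
  shows "F (main_pt (s k)) - F xstar
    \<le> ereal (min (4 / (real k + 1)\<^sup>2) ((1 - sqrt ((\<mu>f + \<mu>\<Psi>) / (L\<^sub>u + \<mu>\<Psi>))) ^ (k - 1)) * (L\<^sub>u - \<mu>f))
      * (ereal (A\<^sub>0 / \<gamma>\<^sub>0) * (F x\<^sub>0 - F xstar) + ereal (1 / 2 * (norm (x\<^sub>0 - xstar))\<^sup>2))"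
proof -
  from assms obtain j where k: "k = Suc j"
    by (cases k) auto
  define c where "c = min (4 / (real k + 1)\<^sup>2) ((1 - sqrt ((\<mu>f + \<mu>\<Psi>) / (L\<^sub>u + \<mu>\<Psi>))) ^ (k - 1))"
  have "\<gamma>\<^sub>0 / (L\<^sub>u - \<mu>f) \<le> c * acc_wt (s k)"
    using acc_wt_quadratic_growth[of j] acc_wt_geometric_growth[of j]
    by (simp add: c_def k min_def del: of_nat_Suc)
  then have "gap (main_pt (s k))
      \<le> c * (L\<^sub>u - \<mu>f) * (A\<^sub>0 / \<gamma>\<^sub>0 * gap x\<^sub>0 + 1 / 2 * (norm (x\<^sub>0 - xstar))\<^sup>2)"
    unfolding k by (rule gap_bound)
  moreover have "F (main_pt (s k)) \<noteq> \<infinity>"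
    using run_invariant(4)[of k] acc_wt_strict_mono[of j] run_invariant(1)[of j] by (simp add: k)
  moreover have "ereal (A\<^sub>0 / \<gamma>\<^sub>0) * (F x\<^sub>0 - F xstar) = ereal (A\<^sub>0 / \<gamma>\<^sub>0 * gap x\<^sub>0)"
  proof (cases "A\<^sub>0 = 0")
    case True
    then show ?thesis by (simp flip: zero_ereal_def)
  next
    case False
    then have "F x\<^sub>0 \<noteq> \<infinity>"
      using feasible A\<^sub>0 by auto
    then show ?thesis
      by (simp add: gap_eq)
  qed
  ultimately show ?thesis
    unfolding c_def[symmetric] by (simp add: gap_eq)
qed

end

theorem theorem3p1:
  fixes f :: "real ^ 'n \<Rightarrow> real"
    and grad_f :: "real ^ 'n \<Rightarrow> real ^ 'n"
    and \<Psi> F :: "real ^ 'n \<Rightarrow> ereal"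
    and L\<^sub>f \<mu>f \<mu>\<Psi> \<mu> L\<^sub>0 A\<^sub>0 \<gamma>\<^sub>0 r\<^sub>u r\<^sub>d L\<^sub>u q\<^sub>u :: real
    and \<Delta>\<^sub>0 :: ereal
    and x\<^sub>0 xstar :: "real ^ 'n"
    and x :: "nat \<Rightarrow> real ^ 'n"
    and s :: "nat \<Rightarrow> (real ^ 'n) acgm_state"
    and monotone_variant :: bool
  assumes "convex_on UNIV f"
    and "\<And>p. GDERIV f p :> grad_f p"
    and "L\<^sub>f > 0"
    and "L\<^sub>f-lipschitz_on UNIV grad_f"
    and "\<mu>f \<ge> 0"
    and "convex_on UNIV (\<lambda>p. f p - \<mu>f / 2 * (norm p)\<^sup>2)"
    and "\<And>p. \<Psi> p \<noteq> -\<infinity>"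
    and "\<exists>p. \<Psi> p \<noteq> \<infinity>"
    and "ereal_convex \<Psi>"
    and "lower_semicontinuous \<Psi>"
    and "\<mu>\<Psi> \<ge> 0"
    and "ereal_convex (\<lambda>p. \<Psi> p - ereal (\<mu>\<Psi> / 2 * (norm p)\<^sup>2))"
    and "\<mu> = \<mu>f + \<mu>\<Psi>"
    and "F = objective f \<Psi>"
    and "is_arg_min F (\<lambda>_. True) xstar"
    and "L\<^sub>0 > 0" and "A\<^sub>0 \<ge> 0" and "\<gamma>\<^sub>0 > 0"
    and "r\<^sub>u > 1" and "0 < r\<^sub>d" and "r\<^sub>d < 1"
    and "A\<^sub>0 > 0 \<Longrightarrow> F x\<^sub>0 < \<infinity>"
    and "s = acgm monotone_variant f grad_f \<Psi> \<mu>f \<mu>\<Psi> r\<^sub>u r\<^sub>d L\<^sub>0 A\<^sub>0 \<gamma>\<^sub>0 x\<^sub>0"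
    and "x = (\<lambda>k. main_pt (s k))"
    and "\<And>k j. j \<le> rejections f grad_f \<Psi> \<mu>f \<mu>\<Psi> r\<^sub>u r\<^sub>d (s k) \<Longrightarrow> trial_L r\<^sub>u r\<^sub>d (s k) j > \<mu>f"
    and "L\<^sub>u = max (r\<^sub>u * L\<^sub>f) (r\<^sub>d * L\<^sub>0)"
    and "q\<^sub>u = \<mu> / (L\<^sub>u + \<mu>\<Psi>)"
    and "\<Delta>\<^sub>0 = ereal (A\<^sub>0 / \<gamma>\<^sub>0) * (F x\<^sub>0 - F xstar) + ereal (1 / 2 * (norm (x\<^sub>0 - xstar))\<^sup>2)"
    and "\<gamma>\<^sub>0 \<ge> A\<^sub>0 * \<mu>"
  shows "\<forall>k\<ge>1. F (x k) - F xstar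
           \<le> ereal (min (4 / (real k + 1)\<^sup>2) ((1 - sqrt q\<^sub>u) ^ (k - 1)) * (L\<^sub>u - \<mu>f)) * \<Delta>\<^sub>0"
proof -
  \<comment> \<open>The accepted trial value is the one whose index is exactly the number of rejections.\<close>
  have "\<mu>f < lip (s (Suc k))" for k
    using assms(25)[of "rejections f grad_f \<Psi> \<mu>f \<mu>\<Psi> r\<^sub>u r\<^sub>d (s k)" k]
    by (simp add: assms(23) acgm_step_def Let_def)
  then interpret acgm_run f grad_f \<Psi> L\<^sub>f \<mu>f \<mu>\<Psi> xstar monotone_variant r\<^sub>u r\<^sub>d L\<^sub>0 A\<^sub>0 \<gamma>\<^sub>0 x\<^sub>0 s L\<^sub>u
    using assms by unfold_locales auto
  show ?thesis
    using F_bound by (simp add: assms(13,14,24,27,28))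
qed

end
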